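(* Let $d\ge1$ and $a_1,\ldots,a_d,m$ be positive integers. If $(a_1,\ldots,a_d)\xrightarrow{\textsc{bm}} m$, then there exists a positive integer $a_{d+1}$ such that $(a_1,\ldots,a_d,a_{d+1})\xrightarrow{\textsc{bm}} m$.
   Context: A hypergraph is identified with its finite edge set; a matching is a set of pairwise disjoint edges. A hypergraph $H$ is $k$-partite with sides $V_1,\ldots,V_k$ (a fixed partition of its vertex set) if $|e\cap V_t|=1$ for every edge $e$ and every $t$. For $f:H\to\mathbb{R}_{\ge0}$, $\deg_f(v)=\sum_{e\ni v}f(e)$; $f$ is balanced if $\deg_f$ is constant on each side. $H$ is $(b_1,\ldots,b_k)$-fractionally balanced if it is $k$-partite with sides of sizes $b_1,\ldots,b_k$ and has a nonzero balanced $f:H\to\mathbb{R}_{\ge0}$. $(b_1,\ldots,b_k)\xrightarrow{\textsc{bm}} m$ means every $(b_1,\ldots,b_k)$-fractionally balanced $k$-partite hypergraph has a matching of size $m$. *)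

theory Defs
  imports Complex_Main
begin

definition matching :: "'v set set \<Rightarrow> bool" where
  "matching M \<longleftrightarrow> pairwise disjnt M"

text \<open>The sides are given as a list \<^term>\<open>Vs\<close>; the vertex set is the union of the sides.\<close>

definition partite_hypergraph :: "'v set set \<Rightarrow> 'v set list \<Rightarrow> bool" where
  "partite_hypergraph H Vs \<longleftrightarrow>
     finite H \<and>
     (\<forall>t < length Vs. finite (Vs ! t)) \<and>
     (\<forall>s < length Vs. \<forall>t < length Vs. s \<noteq> t \<longrightarrow> Vs ! s \<inter> Vs ! t = {}) \<and>
     (\<forall>e \<in> H. e \<subseteq> \<Union>(set Vs)) \<and>
     (\<forall>e \<in> H. \<forall>t < length Vs. card (e \<inter> Vs ! t) = 1)"

definition wdeg :: "'v set set \<Rightarrow> ('v set \<Rightarrow> real) \<Rightarrow> 'v \<Rightarrow> real" where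
  "wdeg H f v = (\<Sum>e \<in> {e \<in> H. v \<in> e}. f e)"

definition balanced :: "'v set set \<Rightarrow> 'v set list \<Rightarrow> ('v set \<Rightarrow> real) \<Rightarrow> bool" where
  "balanced H Vs f \<longleftrightarrow>
     (\<forall>t < length Vs. \<forall>u \<in> Vs ! t. \<forall>v \<in> Vs ! t. wdeg H f u = wdeg H f v)"

definition fractionally_balanced :: "nat list \<Rightarrow> 'v set set \<Rightarrow> bool" where
  "fractionally_balanced bs H \<longleftrightarrow>
     (\<exists>Vs. partite_hypergraph H Vs \<and> map card Vs = bs \<and>
       (\<exists>f. (\<forall>e \<in> H. f e \<ge> 0) \<and> (\<exists>e \<in> H. f e \<noteq> 0) \<and> balanced H Vs f))"

text \<open>The relation \<open>(b\<^sub>1, \<dots>, b\<^sub>k) \<rightarrow> m\<close>. HOL cannot quantify over the type of vertices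
  inside a formula, so the vertices are taken to be natural numbers. As all hypergraphs
  here are finite this is no restriction: see the lemma \<open>bm_arrow_any_type\<close> below.\<close>

definition bm_arrow :: "nat list \<Rightarrow> nat \<Rightarrow> bool" where
  "bm_arrow bs m \<longleftrightarrow>
     (\<forall>H :: nat set set. fractionally_balanced bs H \<longrightarrow>
       (\<exists>M \<subseteq> H. matching M \<and> card M = m))"

lemma bm_arrow_any_type:
  fixes H :: "'v set set"
  assumes "bm_arrow bs m" and "fractionally_balanced bs H"
  shows "\<exists>M \<subseteq> H. matching M \<and> card M = m"
proof -
  obtain Vs f where P: "partite_hypergraph H Vs" and c: "map card Vs = bs"
    and f0: "\<forall>e \<in> H. f e \<ge> 0" and f1: "\<exists>e \<in> H. f e \<noteq> 0" and b: "balanced H Vs f"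
    using assms(2) unfolding fractionally_balanced_def by blast
  have Pf: "finite (Vs ! t)" if "t < length Vs" for t
    using P that unfolding partite_hypergraph_def by blast
  have Pc: "card (e \<inter> Vs ! t) = 1" if "e \<in> H" "t < length Vs" for e t
    using P that unfolding partite_hypergraph_def by blast
  define U where "U = \<Union>(set Vs)"
  have "finite U"
    using Pf unfolding U_def by (intro finite_Union) (auto simp: in_set_conv_nth)
  then obtain g :: "'v \<Rightarrow> nat" where g: "inj_on g U"
    by (metis finite_imp_inj_to_nat_seg)
  have HU: "e \<subseteq> U" if "e \<in> H" for e
    using P that unfolding U_def partite_hypergraph_def by blast
  have VU: "Vs ! t \<subseteq> U" if "t < length Vs" for t
    using nth_mem[OF that] unfolding U_def by blast
  have inj: "inj_on ((`) g) H"
  proof (rule inj_onI)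
    fix x y assume "x \<in> H" "y \<in> H" "g ` x = g ` y"
    then show "x = y" using inj_on_image_eq_iff[OF g HU HU] by simp
  qed
  define H' where "H' = (`) g ` H"
  define Vs' where "Vs' = map ((`) g) Vs"
  define f' where "f' = (\<lambda>e. f (inv_into H ((`) g) e))"
  have f': "f' (g ` e) = f e" if "e \<in> H" for e
    using inv_into_f_f[OF inj that] unfolding f'_def by simp
  have int: "g ` A \<inter> g ` B = g ` (A \<inter> B)" if "A \<subseteq> U" "B \<subseteq> U" for A B
    using inj_on_image_Int[OF g that] by simp
  have cd: "card (g ` A) = card A" if "A \<subseteq> U" for A
    using card_image inj_on_subset[OF g that] by blast
  have len: "length Vs' = length Vs" unfolding Vs'_def by simp
  have nth: "Vs' ! t = g ` (Vs ! t)" if "t < length Vs" for t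
    using that unfolding Vs'_def by simp
  have "partite_hypergraph H' Vs'"
    unfolding partite_hypergraph_def len
  proof (intro conjI)
    show "finite H'"
      using P unfolding H'_def partite_hypergraph_def by (intro finite_imageI) (rule conjunct1)
    show "\<forall>t < length Vs. finite (Vs' ! t)"
      using Pf nth by simp
    show "\<forall>s < length Vs. \<forall>t < length Vs. s \<noteq> t \<longrightarrow> Vs' ! s \<inter> Vs' ! t = {}"
    proof (intro allI impI)
      fix s t assume st: "s < length Vs" "t < length Vs" "s \<noteq> t"
      then have "Vs ! s \<inter> Vs ! t = {}"
        using P unfolding partite_hypergraph_def by blast
      then show "Vs' ! s \<inter> Vs' ! t = {}"
        using int[OF VU[OF st(1)] VU[OF st(2)]] nth[OF st(1)] nth[OF st(2)] by simp
    qed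
    show "\<forall>e \<in> H'. e \<subseteq> \<Union>(set Vs')"
    proof
      fix e' assume "e' \<in> H'"
      then obtain e where e: "e \<in> H" "e' = g ` e" unfolding H'_def by blast
      have "\<Union>(set Vs') = g ` U" unfolding Vs'_def U_def by (simp add: image_Union)
      then show "e' \<subseteq> \<Union>(set Vs')" using image_mono[OF HU[OF e(1)]] e(2) by simp
    qed
    show "\<forall>e \<in> H'. \<forall>t < length Vs. card (e \<inter> Vs' ! t) = 1"
    proof (intro ballI allI impI)
      fix e' t assume "e' \<in> H'" and t: "t < length Vs"
      then obtain e where e: "e \<in> H" "e' = g ` e" unfolding H'_def by blast
      have "card (e' \<inter> Vs' ! t) = card (e \<inter> Vs ! t)"
        using e(2) nth[OF t] int[OF HU[OF e(1)] VU[OF t]]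
          cd[OF le_infI1[OF HU[OF e(1)], of "Vs ! t"]] by simp
      then show "card (e' \<inter> Vs' ! t) = 1"
        using Pc[OF e(1) t] by simp
    qed
  qed
  moreover have "map card Vs' = bs"
    unfolding c[symmetric]
  proof (rule nth_equalityI)
    show "length (map card Vs') = length (map card Vs)" using len by simp
    fix t assume "t < length (map card Vs')"
    then have t: "t < length Vs" using len by simp
    show "map card Vs' ! t = map card Vs ! t"
      using t len nth[OF t] cd[OF VU[OF t]] by simp
  qed
  moreover have "\<forall>e \<in> H'. f' e \<ge> 0" "\<exists>e \<in> H'. f' e \<noteq> 0"
    using f0 f1 f' unfolding H'_def by auto
  moreover have "balanced H' Vs' f'"
  proof -
    have deg: "wdeg H' f' (g v) = wdeg H f v" if "v \<in> U" for v
    proof -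
      have "g v \<in> g ` e \<longleftrightarrow> v \<in> e" if "e \<in> H" for e
        using inj_on_image_mem_iff[OF g \<open>v \<in> U\<close> HU[OF that]] .
      then have "{e \<in> H'. g v \<in> e} = (`) g ` {e \<in> H. v \<in> e}"
        unfolding H'_def by (auto simp del: image_iff)
      moreover have "inj_on ((`) g) {e \<in> H. v \<in> e}"
        by (rule inj_on_subset[OF inj]) auto
      ultimately show ?thesis
        unfolding wdeg_def by (simp add: sum.reindex f')
    qed
    show ?thesis
      unfolding balanced_def len
    proof (intro allI impI ballI)
      fix t u' v' assume t: "t < length Vs" and "u' \<in> Vs' ! t" "v' \<in> Vs' ! t"
      then obtain u v where uv: "u \<in> Vs ! t" "v \<in> Vs ! t" "u' = g u" "v' = g v"
        using nth[OF t] by blast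
      then have "wdeg H f u = wdeg H f v"
        using b t unfolding balanced_def by blast
      moreover have "u \<in> U" "v \<in> U" using uv VU[OF t] by auto
      ultimately show "wdeg H' f' u' = wdeg H' f' v'"
        using uv deg by simp
    qed
  qed
  ultimately have "fractionally_balanced bs H'"
    unfolding fractionally_balanced_def by blast
  then obtain M' where M': "M' \<subseteq> H'" "matching M'" "card M' = m"
    using assms(1) unfolding bm_arrow_def by blast
  then obtain M where M: "M \<subseteq> H" "M' = (`) g ` M"
    unfolding H'_def by (meson subset_image_iff)
  have injM: "inj_on ((`) g) M" using inj_on_subset[OF inj M(1)] .
  have "card M = m" using M'(3) M(2) card_image[OF injM] by simp
  moreover have "matching M"
    unfolding matching_def pairwise_def
  proof (intro ballI impI)
    fix x y assume xy: "x \<in> M" "y \<in> M" "x \<noteq> y"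
    then have "g ` x \<noteq> g ` y" using injM unfolding inj_on_def by blast
    then have "disjnt (g ` x) (g ` y)"
      using M'(2) xy(1,2) pairwiseD[of disjnt M' "g ` x" "g ` y"]
      unfolding matching_def M(2) by simp
    then show "disjnt x y" unfolding disjnt_def by blast
  qed
  ultimately show ?thesis using M(1) by blast
qed

end

theory Submission
  imports Defs
begin

text \<open>By compactness, the arrow for \<open>(a\<^sub>1, \<dots>, a\<^sub>d)\<close> is robust: there is \<open>\<epsilon> > 0\<close> such that every
  balanced weight of total 1 on the complete \<open>d\<close>-partite hypergraph has a matching of size \<open>m\<close>
  all of whose edges have weight at least \<open>\<epsilon>\<close>. Take \<open>a\<^sub>d\<^sub>+\<^sub>1 \<ge> m / \<epsilon>\<close>. Projecting a balanced weight
  to the first \<open>d\<close> sides keeps it balanced, and each vertex of the last side carries a fraction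
  \<open>1 / a\<^sub>d\<^sub>+\<^sub>1\<close> of the total, so an edge of projected weight at least \<open>\<epsilon>\<close> extends to at
  least \<open>\<epsilon> a\<^sub>d\<^sub>+\<^sub>1 \<ge> m\<close> vertices of the last side. Hence the \<open>m\<close> matching edges extend greedily to
  distinct vertices of the last side.\<close>

section \<open>Convergent subsequences and distinct representatives\<close>

text \<open>Bolzano-Weierstrass one coordinate at a time: each new index costs a further monotone,
  hence convergent, subsequence, which keeps the limits found before.\<close>

lemma finite_family_convergent_subseq:
  fixes x :: "nat \<Rightarrow> 'e \<Rightarrow> real"
  assumes "finite E" and "\<And>n e. e \<in> E \<Longrightarrow> \<bar>x n e\<bar> \<le> B"
  shows "\<exists>r l. strict_mono (r :: nat \<Rightarrow> nat) \<and> (\<forall>e \<in> E. (\<lambda>n. x (r n) e) \<longlonglongrightarrow> l e)"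
  using assms
proof (induction E rule: finite_induct)
  case empty
  then show ?case by (intro exI[of _ id]) (auto simp: strict_mono_def)
next
  case (insert a E)
  then obtain r l where r: "strict_mono (r :: nat \<Rightarrow> nat)"
    and l: "\<forall>e \<in> E. (\<lambda>n. x (r n) e) \<longlonglongrightarrow> l e" by blast
  obtain s :: "nat \<Rightarrow> nat" where s: "strict_mono s" "monoseq (\<lambda>n. x (r (s n)) a)"
    using seq_monosub[of "\<lambda>n. x (r n) a"] by blast
  have "Bseq (\<lambda>n. x (r (s n)) a)"
    using insert.prems by (intro BseqI'[of _ B]) auto
  then obtain k where k: "(\<lambda>n. x (r (s n)) a) \<longlonglongrightarrow> k"
    using Bseq_monoseq_convergent s(2) unfolding convergent_def by blast
  have "(\<lambda>n. x ((r \<circ> s) n) e) \<longlonglongrightarrow> (l(a := k)) e" if "e \<in> insert a E" for e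
    using that k l LIMSEQ_subseq_LIMSEQ[OF _ s(1), of "\<lambda>n. x (r n) e"] by (auto simp: o_def)
  then show ?case using strict_mono_o[OF r s(1)] by blast
qed

text \<open>Greedy choice: the representatives already picked never exhaust the next set.\<close>

lemma distinct_representatives_of_large_sets:
  assumes "finite M" and "\<And>e. e \<in> M \<Longrightarrow> finite (A e) \<and> card M \<le> card (A e)"
  shows "\<exists>w. inj_on w M \<and> (\<forall>e \<in> M. w e \<in> A e)"
  using assms
proof (induction M rule: finite_induct)
  case empty
  then show ?case by simp
next
  case (insert a M)
  have "finite (A e) \<and> card M \<le> card (A e)" if "e \<in> M" for e
    using insert.prems[of e] that insert.hyps by simp
  with insert.IH obtain w where w: "inj_on w M" "\<forall>e \<in> M. w e \<in> A e" by blast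
  \<comment> \<open>Strict because \<open>a\<close> is new: \<open>card (insert a M)\<close> is
    \<open>card M + 1\<close>, while \<open>w\<close> takes at most \<open>card M\<close> values on
    \<open>M\<close>.\<close>
  have "card (w ` M) < card (A a)"
    using insert.prems[of a] insert.hyps card_image_le[of M w] by simp
  then obtain b where b: "b \<in> A a" "b \<notin> w ` M"
    using insert.hyps(1) by (metis card_mono finite_imageI leD subsetI)
  have "inj_on (w(a := b)) (insert a M)"
    using w(1) b(2) insert.hyps(2) by (auto simp: inj_on_def)
  moreover have "\<forall>e \<in> insert a M. (w(a := b)) e \<in> A e"
    using w(2) b(1) by simp
  ultimately show ?case by blast
qed

section \<open>Standard sides and the complete partite hypergraph\<close>

text \<open>A single fixed vertex set puts all weights into one finite-dimensional space, where
  compactness applies. The tag \<open>t\<close> keeps the sides disjoint.\<close>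

definition std_sides :: "nat list \<Rightarrow> (nat \<times> nat) set list" where
  "std_sides as = map (\<lambda>t. {t} \<times> {0..<as ! t}) [0..<length as]"

text \<open>For disjoint sides this is the complete partite hypergraph, which contains every partite
  hypergraph with these sides.\<close>

definition transversals :: "'v set list \<Rightarrow> 'v set set" where
  "transversals Vs = {e. e \<subseteq> \<Union>(set Vs) \<and> (\<forall>t < length Vs. card (e \<inter> Vs ! t) = 1)}"

lemma length_std_sides [simp]: "length (std_sides as) = length as"
  by (simp add: std_sides_def)

lemma nth_std_sides [simp]: "t < length as \<Longrightarrow> std_sides as ! t = {t} \<times> {0..<as ! t}"
  by (simp add: std_sides_def)

lemma map_card_std_sides: "map card (std_sides as) = as"
  by (rule nth_equalityI) (simp_all add: card_cartesian_product_singleton)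

lemma finite_transversals_std_sides: "finite (transversals (std_sides as))"
proof (rule finite_subset)
  show "transversals (std_sides as) \<subseteq> Pow (\<Union>(set (std_sides as)))"
    by (auto simp: transversals_def)
qed (auto simp: std_sides_def)

lemma partite_hypergraph_std_sides:
  assumes "H \<subseteq> transversals (std_sides as)"
  shows "partite_hypergraph H (std_sides as)"
  using assms finite_subset[OF assms finite_transversals_std_sides]
  unfolding partite_hypergraph_def transversals_def by auto

section \<open>Limits of balanced weights and robustness of the arrow\<close>

lemma balanced_limit:
  assumes "\<And>n. balanced H Vs (f n)" and "\<And>e. e \<in> H \<Longrightarrow> (\<lambda>n. f n e) \<longlonglongrightarrow> l e"
  shows "balanced H Vs l"
  unfolding balanced_def
proof (intro allI impI ballI)
  fix t u v assume t: "t < length Vs" "u \<in> Vs ! t" "v \<in> Vs ! t"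
  have lim: "(\<lambda>n. wdeg H (f n) z) \<longlonglongrightarrow> wdeg H l z" for z
    unfolding wdeg_def by (intro tendsto_sum) (simp add: assms(2))
  have "wdeg H (f n) u = wdeg H (f n) v" for n
    using assms(1)[of n] t unfolding balanced_def by blast
  with lim[of u] lim[of v] show "wdeg H l u = wdeg H l v"
    by (simp add: LIMSEQ_unique)
qed

text \<open>Weights violating the claim for ever smaller thresholds accumulate at a balanced weight
  \<open>l\<close> of total 1. The arrow gives a matching inside the support of \<open>l\<close>,
  and its edges beat the vanishing thresholds far along the sequence.\<close>

lemma bm_arrow_robust:
  assumes "bm_arrow as m"
  defines "E \<equiv> transversals (std_sides as)"
  shows "\<exists>\<epsilon>>0. \<forall>f. (\<forall>e \<in> E. f e \<ge> 0) \<longrightarrow> sum f E = 1 \<longrightarrow> balanced E (std_sides as) f \<longrightarrow>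
    (\<exists>M \<subseteq> E. matching M \<and> card M = m \<and> (\<forall>e \<in> M. f e \<ge> \<epsilon>))"
proof (rule ccontr)
  assume neg: "\<not> ?thesis"
  have finE: "finite E" unfolding E_def by (rule finite_transversals_std_sides)
  have "\<exists>f. (\<forall>e \<in> E. f e \<ge> 0) \<and> sum f E = 1 \<and> balanced E (std_sides as) f \<and>
    \<not> (\<exists>M \<subseteq> E. matching M \<and> card M = m \<and> (\<forall>e \<in> M. f e \<ge> inverse (real (Suc n))))" for n
  proof -
    have "inverse (real (Suc n)) > 0" by simp
    with neg show ?thesis by blast
  qed
  then obtain f where f0: "\<And>n e. e \<in> E \<Longrightarrow> f n e \<ge> 0" and f1: "\<And>n. sum (f n) E = 1"
    and fb: "\<And>n. balanced E (std_sides as) (f n)"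
    and fM: "\<And>n M. M \<subseteq> E \<Longrightarrow> matching M \<Longrightarrow> card M = m \<Longrightarrow>
      \<exists>e \<in> M. f n e < inverse (real (Suc n))"
    by (metis not_le)
  have "\<bar>f n e\<bar> \<le> 1" if "e \<in> E" for n e
    using f0[OF that] member_le_sum[OF that, of "f n"] f0 finE f1[of n] by force
  then obtain r l where r: "strict_mono (r :: nat \<Rightarrow> nat)"
    and l: "\<And>e. e \<in> E \<Longrightarrow> (\<lambda>n. f (r n) e) \<longlonglongrightarrow> l e"
    using finite_family_convergent_subseq[OF finE, of f 1] by blast
  have l0: "l e \<ge> 0" if "e \<in> E" for e
    using LIMSEQ_le_const[OF l[OF that]] f0[OF that] by blast
  have "(\<lambda>n. sum (f (r n)) E) \<longlonglongrightarrow> sum l E"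
    by (intro tendsto_sum l)
  then have l1: "sum l E = 1"
    using f1 by (simp add: LIMSEQ_const_iff)
  have lb: "balanced E (std_sides as) l"
    by (rule balanced_limit[where f = "\<lambda>n. f (r n)", OF fb l])
  \<comment> \<open>The arrow is applied to the support of \<open>l\<close>, not to
    \<open>E\<close>: the matching then uses only edges of positive limit weight, and discarding
    edges of weight 0 changes no degree.\<close>
  define H where "H = {e \<in> E. l e \<noteq> 0}"
  have deg: "wdeg H l v = wdeg E l v" for v
    unfolding wdeg_def H_def using finE by (intro sum.mono_neutral_left) auto
  have "balanced H (std_sides as) l"
    using lb unfolding balanced_def deg .
  moreover have "\<exists>e \<in> H. l e \<noteq> 0"
  proof (rule ccontr)
    assume "\<not> ?thesis"
    then have "sum l E = 0" unfolding H_def by (intro sum.neutral) blast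
    with l1 show False by simp
  qed
  moreover have "\<forall>e \<in> H. l e \<ge> 0" using l0 unfolding H_def by blast
  moreover have "partite_hypergraph H (std_sides as)"
    by (rule partite_hypergraph_std_sides) (auto simp: H_def E_def)
  ultimately have "fractionally_balanced as H"
    unfolding fractionally_balanced_def using map_card_std_sides by blast
  then obtain M where M: "M \<subseteq> H" "matching M" "card M = m"
    using bm_arrow_any_type[OF assms(1)] by blast
  have "finite M" using finite_subset[OF M(1)] finE unfolding H_def by simp
  \<comment> \<open>The weight tends to \<open>l e > 0\<close> and the threshold to 0. As
    \<open>M\<close> is finite, one index then serves all its edges.\<close>
  have "eventually (\<lambda>n. inverse (real (Suc (r n))) < f (r n) e) sequentially" if "e \<in> M" for e
  proof -
    have e: "e \<in> E" "0 < l e" using that M(1) l0[of e] unfolding H_def by force+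
    have "(\<lambda>n. inverse (real (Suc (r n)))) \<longlonglongrightarrow> 0"
      using LIMSEQ_subseq_LIMSEQ[OF LIMSEQ_inverse_real_of_nat r] by (simp add: o_def)
    then have "(\<lambda>n. f (r n) e - inverse (real (Suc (r n)))) \<longlonglongrightarrow> l e - 0"
      by (intro tendsto_diff l e(1))
    with e(2) have "eventually (\<lambda>n. 0 < f (r n) e - inverse (real (Suc (r n)))) sequentially"
      by (intro order_tendstoD(1)) auto
    then show ?thesis by (rule eventually_mono) simp
  qed
  then have "eventually (\<lambda>n. \<forall>e \<in> M. inverse (real (Suc (r n))) < f (r n) e) sequentially"
    using \<open>finite M\<close> by (simp add: eventually_ball_finite)
  then obtain n where "\<forall>e \<in> M. inverse (real (Suc (r n))) < f (r n) e"
    using eventually_happens' sequentially_bot by blast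
  moreover have "M \<subseteq> E" using M(1) unfolding H_def by blast
  ultimately show False using fM[of M "r n"] M by force
qed

section \<open>Transporting arbitrary sides to the standard ones\<close>

text \<open>Disjointness gives every vertex of a side a unique index, so numberings of the separate
  sides glue to one map.\<close>

lemma sides_relabel:
  assumes "\<And>t. t < length Vs \<Longrightarrow> finite (Vs ! t)"
    and disj: "\<And>s t. s < length Vs \<Longrightarrow> t < length Vs \<Longrightarrow> s \<noteq> t \<Longrightarrow> Vs ! s \<inter> Vs ! t = {}"
  shows "\<exists>g. \<forall>t < length Vs. bij_betw g (Vs ! t) ({t} \<times> {0..<card (Vs ! t)})"
proof -
  have "\<forall>t. \<exists>b. t < length Vs \<longrightarrow> bij_betw b (Vs ! t) {0..<card (Vs ! t)}"
    using assms(1) ex_bij_betw_finite_nat by blast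
  then obtain b where b: "\<And>t. t < length Vs \<Longrightarrow> bij_betw (b t) (Vs ! t) {0..<card (Vs ! t)}"
    by metis
  define idx where "idx v = (SOME t. t < length Vs \<and> v \<in> Vs ! t)" for v
  have idx: "idx v = t" if "t < length Vs" "v \<in> Vs ! t" for t v
    using someI[of "\<lambda>t. t < length Vs \<and> v \<in> Vs ! t" t] that disj[of "idx v" t]
    unfolding idx_def[symmetric] by blast
  have "bij_betw (\<lambda>v. (idx v, b (idx v) v)) (Vs ! t) ({t} \<times> {0..<card (Vs ! t)})"
    if t: "t < length Vs" for t
  proof -
    have "bij_betw (\<lambda>v. (t, b t v)) (Vs ! t) ({t} \<times> {0..<card (Vs ! t)})"
      using b[OF t] unfolding bij_betw_def inj_on_def by auto
    then show ?thesis
      by (rule bij_betw_cong[THEN iffD1, rotated]) (simp add: idx[OF t])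
  qed
  then show ?thesis by blast
qed

text \<open>The first component of \<open>g v\<close> recovers the side of \<open>v\<close>, and
  \<open>g\<close> is injective on each side.\<close>

lemma relabel_inj:
  assumes g: "\<And>t. t < length Vs \<Longrightarrow> bij_betw g (Vs ! t) ({t} \<times> {0..<as ! t})"
  shows "inj_on g (\<Union>(set Vs))"
proof (rule inj_onI)
  have gm: "g v \<in> {t} \<times> {0..<as ! t}" if "t < length Vs" "v \<in> Vs ! t" for t v
    using g that unfolding bij_betw_def by blast
  fix u v assume "u \<in> \<Union>(set Vs)" "v \<in> \<Union>(set Vs)" and eq: "g u = g v"
  then obtain s t where st: "s < length Vs" "u \<in> Vs ! s" "t < length Vs" "v \<in> Vs ! t"
    by (auto simp: in_set_conv_nth)
  then have "s = t" using gm[OF st(1,2)] gm[OF st(3,4)] eq by auto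
  then show "u = v" using st eq g[OF st(1)] unfolding bij_betw_def inj_on_def by blast
qed

text \<open>Here \<open>x\<close> may have vertices outside \<open>Vs\<close>. For an edge with one
  more side the intersection discards the extra vertex, so this is the projection to the first
  sides.\<close>

lemma relabel_transversal:
  assumes "length as = length Vs"
    and g: "\<And>t. t < length Vs \<Longrightarrow> bij_betw g (Vs ! t) ({t} \<times> {0..<as ! t})"
    and x: "\<And>t. t < length Vs \<Longrightarrow> card (x \<inter> Vs ! t) = 1"
  shows "g ` (x \<inter> \<Union>(set Vs)) \<in> transversals (std_sides as)"
proof -
  have inj: "inj_on g (\<Union>(set Vs))" using g by (rule relabel_inj)
  have gm: "g v \<in> {t} \<times> {0..<as ! t}" if "t < length Vs" "v \<in> Vs ! t" for t v
    using g that unfolding bij_betw_def by blast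
  have "g ` (x \<inter> \<Union>(set Vs)) \<subseteq> \<Union>(set (std_sides as))"
  proof
    fix c assume "c \<in> g ` (x \<inter> \<Union>(set Vs))"
    then obtain t v where "t < length Vs" "v \<in> Vs ! t" "c = g v"
      by (auto simp: in_set_conv_nth)
    then have "c \<in> std_sides as ! t" using gm assms(1) by simp
    then show "c \<in> \<Union>(set (std_sides as))"
      using \<open>t < length Vs\<close> assms(1) by (metis UnionI length_std_sides nth_mem)
  qed
  moreover have "card (g ` (x \<inter> \<Union>(set Vs)) \<inter> std_sides as ! t) = 1" if t: "t < length as" for t
  proof -
    have tV: "t < length Vs" using t assms(1) by simp
    have sub: "Vs ! t \<subseteq> \<Union>(set Vs)" using nth_mem[OF tV] by blast
    have "std_sides as ! t = g ` (Vs ! t)"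
      using g[OF tV] t unfolding bij_betw_def by simp
    then have "g ` (x \<inter> \<Union>(set Vs)) \<inter> std_sides as ! t = g ` (x \<inter> Vs ! t)"
      using inj_on_image_Int[OF inj, of "x \<inter> \<Union>(set Vs)" "Vs ! t"] sub
      by (simp add: Int_assoc Int_absorb1)
    moreover have "inj_on g (x \<inter> Vs ! t)" using inj sub by (meson inj_on_subset le_infI2)
    ultimately show ?thesis using x[OF tV] by (simp add: card_image)
  qed
  ultimately show "g ` (x \<inter> \<Union>(set Vs)) \<in> transversals (std_sides as)"
    unfolding transversals_def by simp
qed

section \<open>Counting weight through one side\<close>

text \<open>Each edge has just one vertex in \<open>W\<close>; grouping the edges of
  \<open>H\<close> by it gives classes of weight \<open>c\<close>. The edges of \<open>S\<close>
  meet only the classes of the vertices they contain, and non-negativity bounds their share of each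
  class by \<open>c\<close>.\<close>

lemma sum_le_card_side_times_degree:
  assumes "finite H" "finite W" and W: "\<And>x. x \<in> H \<Longrightarrow> card (x \<inter> W) = 1"
    and f: "\<And>x. x \<in> H \<Longrightarrow> (f x :: real) \<ge> 0" and c: "\<And>w. w \<in> W \<Longrightarrow> wdeg H f w = c"
  shows "S \<subseteq> H \<Longrightarrow> sum f S \<le> real (card {w \<in> W. \<exists>x \<in> S. w \<in> x}) * c"
    and "sum f H = real (card W) * c"
proof -
  define k where "k x = the_elem (x \<inter> W)" for x
  have k: "x \<inter> W = {k x}" if "x \<in> H" for x
    using W[OF that] unfolding k_def by (metis card_1_singletonE the_elem_eq)
  have deg: "sum f {x \<in> H. k x = w} = c" if "w \<in> W" for w
  proof -
    have "{x \<in> H. k x = w} = {x \<in> H. w \<in> x}"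
    proof (intro Collect_cong conj_cong refl)
      fix x assume "x \<in> H"
      then have "x \<inter> W = {k x}" by (rule k)
      then have "w \<in> x \<inter> W \<longleftrightarrow> w = k x" by simp
      with that show "k x = w \<longleftrightarrow> w \<in> x" by auto
    qed
    then show ?thesis using c[OF that] unfolding wdeg_def by simp
  qed
  have "sum f H = (\<Sum>w \<in> W. sum f {x \<in> H. k x = w})"
    using k by (intro sum.group[symmetric] assms) blast
  then show "sum f H = real (card W) * c" using deg by simp
  assume S: "S \<subseteq> H"
  let ?A = "{w \<in> W. \<exists>x \<in> S. w \<in> x}"
  have "sum f S = (\<Sum>w \<in> ?A. sum f {x \<in> S. k x = w})"
    using k S assms by (intro sum.group[symmetric]) (auto intro: finite_subset)
  also have "\<dots> \<le> (\<Sum>w \<in> ?A. sum f {x \<in> H. k x = w})"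
    using S assms by (intro sum_mono sum_mono2) auto
  also have "\<dots> = real (card ?A) * c" using deg by simp
  finally show "sum f S \<le> real (card ?A) * c" .
qed

section \<open>Extending matchings into a large last side\<close>

theorem theorem5p1:
  fixes d m :: nat and as :: "nat list"
  assumes "d \<ge> 1" and "length as = d"
    and "\<forall>a \<in> set as. a > 0" and "m > 0"
    and "bm_arrow as m"
  shows "\<exists>a' :: nat. a' > 0 \<and> bm_arrow (as @ [a']) m"
proof -
  define E where "E = transversals (std_sides as)"
  have finE: "finite E" unfolding E_def by (rule finite_transversals_std_sides)
  obtain \<epsilon> :: real where \<epsilon>: "\<epsilon> > 0"
    and robust: "\<And>f. (\<forall>e \<in> E. f e \<ge> 0) \<Longrightarrow> sum f E = 1 \<Longrightarrow> balanced E (std_sides as) f \<Longrightarrow>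
      \<exists>M \<subseteq> E. matching M \<and> card M = m \<and> (\<forall>e \<in> M. f e \<ge> \<epsilon>)"
    using bm_arrow_robust[OF assms(5)] unfolding E_def by blast
  \<comment> \<open>Large enough for \<open>\<epsilon> * a' \<ge> m\<close>; the \<open>Suc\<close>
    makes the last side visibly nonempty.\<close>
  define a' where "a' = Suc (nat \<lceil>real m / \<epsilon>\<rceil>)"
  have "real m / \<epsilon> \<le> real a'" unfolding a'_def by linarith
  then have a': "real m \<le> \<epsilon> * real a'" using \<epsilon> by (simp add: field_simps)
  have "bm_arrow (as @ [a']) m"
    unfolding bm_arrow_def
  proof (intro allI impI)
    fix H :: "nat set set" assume "fractionally_balanced (as @ [a']) H"
    then obtain Vs' f where P': "partite_hypergraph H Vs'" and cd': "map card Vs' = as @ [a']"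
      and f0: "\<And>x. x \<in> H \<Longrightarrow> f x \<ge> 0" and f1: "\<exists>x \<in> H. f x \<noteq> 0" and fb': "balanced H Vs' f"
      unfolding fractionally_balanced_def by blast
    obtain Vs W where Vs': "Vs' = Vs @ [W]" and cd: "map card Vs = as" and cW: "card W = a'"
      using cd' by (auto simp: map_eq_append_conv)
    have len: "length as = length Vs" using cd by auto
    have cardVs: "as ! t = card (Vs ! t)" if "t < length Vs" for t
      using cd that by auto
    have finH: "finite H" using P' unfolding partite_hypergraph_def by blast
    have nthV: "Vs' ! t = Vs ! t" if "t < length Vs" for t
      using that Vs' by (simp add: nth_append)
    have nthW: "Vs' ! length Vs = W" and len': "length Vs' = Suc (length Vs)"
      using Vs' by simp_all
    have finV: "finite (Vs ! t)" if "t < length Vs" for t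
      using P' that nthV len' unfolding partite_hypergraph_def by (metis less_SucI)
    have disjV: "Vs ! s \<inter> Vs ! t = {}" if "s < length Vs" "t < length Vs" "s \<noteq> t" for s t
      using P' that nthV len' unfolding partite_hypergraph_def by (metis less_SucI)
    have cV: "card (x \<inter> Vs ! t) = 1" if "x \<in> H" "t < length Vs" for x t
      using P' that nthV len' unfolding partite_hypergraph_def by (metis less_SucI)
    have xW: "card (x \<inter> W) = 1" if "x \<in> H" for x
      using P' that nthW len' unfolding partite_hypergraph_def by (metis lessI)
    have finW: "finite W"
      using P' nthW len' unfolding partite_hypergraph_def by (metis lessI)
    have degV: "wdeg H f u = wdeg H f v" if "t < length Vs" "u \<in> Vs ! t" "v \<in> Vs ! t" for t u v
      using fb' that nthV len' unfolding balanced_def by (metis less_SucI)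
    have degW: "wdeg H f u = wdeg H f v" if "u \<in> W" "v \<in> W" for u v
      using fb' that nthW len' unfolding balanced_def by (metis lessI)
    define U where "U = \<Union>(set Vs)"
    have xUW: "x \<subseteq> U \<union> W" if "x \<in> H" for x
      using P' that unfolding partite_hypergraph_def Vs' U_def by auto
    obtain g where "\<forall>t < length Vs. bij_betw g (Vs ! t) ({t} \<times> {0..<card (Vs ! t)})"
      using sides_relabel[OF finV disjV] by blast
    then have g: "bij_betw g (Vs ! t) ({t} \<times> {0..<as ! t})" if "t < length Vs" for t
      using that cardVs by simp
    \<comment> \<open>Projection of an edge to the standard sides. Edges that differ only in their
      vertex in \<open>W\<close> have the same image.\<close>
    define p where "p x = g ` (x \<inter> U)" for x
    have pE: "p x \<in> E" if "x \<in> H" for x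
      using relabel_transversal[OF len g cV[OF that]]
      unfolding p_def E_def U_def by blast
    have inj: "inj_on g U" unfolding U_def using g by (rule relabel_inj)
    have pmem: "g v \<in> p x \<longleftrightarrow> v \<in> x" if "v \<in> U" for v x
      using inj_on_image_mem_iff[OF inj that, of "x \<inter> U"] that unfolding p_def by simp
    obtain w0 where "w0 \<in> W" using cW unfolding a'_def by fastforce
    define c where "c = wdeg H f w0"
    have c: "wdeg H f w = c" if "w \<in> W" for w
      using degW[OF that \<open>w0 \<in> W\<close>] unfolding c_def .
    have total: "sum f H = real a' * c"
      using sum_le_card_side_times_degree(2)[where f = f, OF finH finW xW f0 c] cW by simp
    have "sum f H > 0"
      using f0 f1 finH by (metis less_eq_real_def sum_nonneg sum_nonneg_eq_0_iff)
    then have c0: "c > 0" unfolding total by (simp add: zero_less_mult_iff)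
    \<comment> \<open>The push-forward of \<open>f\<close> along \<open>p\<close>, scaled to total 1
      so that \<open>robust\<close> applies.\<close>
    define h where "h e = sum f {x \<in> H. p x = e} / sum f H" for e
    have "\<forall>e \<in> E. h e \<ge> 0"
      unfolding h_def using f0 \<open>sum f H > 0\<close> by (auto intro!: divide_nonneg_pos sum_nonneg)
    moreover have "sum h E = 1"
    proof -
      have "(\<Sum>e \<in> E. sum f {x \<in> H. p x = e}) = sum f H"
        using pE by (intro sum.group finH finE) blast
      then show ?thesis
        unfolding h_def using \<open>sum f H > 0\<close> by (simp flip: sum_divide_distrib)
    qed
    moreover have "balanced E (std_sides as) h"
    proof -
      \<comment> \<open>Since \<open>p\<close> preserves incidence with vertices of
        \<open>U\<close>, its fibres over the edges through \<open>g v\<close> partition the edges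
        of \<open>H\<close> through \<open>v\<close>.\<close>
      have deg: "wdeg E h (g v) = wdeg H f v / sum f H" if v: "v \<in> U" for v
      proof -
        have "(\<Sum>e \<in> {e \<in> E. g v \<in> e}. sum f {x \<in> H. p x = e}) =
          (\<Sum>e \<in> {e \<in> E. g v \<in> e}. sum f {x \<in> {x \<in> H. v \<in> x}. p x = e})"
          by (intro sum.cong refl arg_cong[of _ _ "sum f"]) (use pmem[OF v] in auto)
        also have "\<dots> = sum f {x \<in> H. v \<in> x}"
          using pE pmem[OF v] finE finH by (intro sum.group) auto
        finally show ?thesis
          unfolding wdeg_def h_def by (simp flip: sum_divide_distrib)
      qed
      show ?thesis
        unfolding balanced_def length_std_sides
      proof (intro allI impI ballI)
        fix t y z assume t: "t < length as" and yz: "y \<in> std_sides as ! t" "z \<in> std_sides as ! t"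
        have tV: "t < length Vs" using t len by simp
        have "std_sides as ! t = g ` (Vs ! t)"
          using g[OF tV] t unfolding bij_betw_def by simp
        with yz obtain u v where uv: "u \<in> Vs ! t" "v \<in> Vs ! t" "y = g u" "z = g v" by auto
        moreover have "u \<in> U" "v \<in> U" using uv nth_mem[OF tV] unfolding U_def by blast+
        ultimately show "wdeg E h y = wdeg E h z" using deg degV[OF tV uv(1,2)] by simp
      qed
    qed
    ultimately obtain M where M: "M \<subseteq> E" "matching M" "card M = m" "\<forall>e \<in> M. h e \<ge> \<epsilon>"
      using robust by blast
    \<comment> \<open>The vertices of the last side by which \<open>e\<close> extends to an edge of
      \<open>H\<close>.\<close>
    define A where "A e = {w \<in> W. \<exists>x \<in> {x \<in> H. p x = e}. w \<in> x}" for e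
    have "finite (A e) \<and> card M \<le> card (A e)" if "e \<in> M" for e
    proof -
      \<comment> \<open>The fibre over \<open>e\<close> has at least the share
        \<open>\<epsilon>\<close> of the total \<open>a' * c\<close>, but each vertex of
        \<open>W\<close> accounts for at most \<open>c\<close> of it.\<close>
      have "\<epsilon> * (real a' * c) \<le> sum f {x \<in> H. p x = e}"
        using M(4) that \<open>sum f H > 0\<close> unfolding h_def total by (simp add: pos_le_divide_eq)
      also have "\<dots> \<le> real (card (A e)) * c"
        using sum_le_card_side_times_degree(1)[where f = f, OF finH finW xW f0 c, of "{x \<in> H. p x = e}"]
        unfolding A_def by blast
      finally have "\<epsilon> * real a' \<le> real (card (A e))" using c0 by simp
      with a' M(3) have "card M \<le> card (A e)" by linarith
      then show ?thesis using finW unfolding A_def by simp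
    qed
    then obtain w where w: "inj_on w M" "\<forall>e \<in> M. w e \<in> A e"
      using distinct_representatives_of_large_sets[of M A] finite_subset[OF M(1) finE] by blast
    then have "\<forall>e \<in> M. \<exists>x \<in> H. p x = e \<and> w e \<in> x \<and> w e \<in> W" unfolding A_def by blast
    then obtain X where X: "\<And>e. e \<in> M \<Longrightarrow> X e \<in> H \<and> p (X e) = e \<and> w e \<in> X e \<and> w e \<in> W"
      by metis
    have XW: "X e \<inter> W = {w e}" if "e \<in> M" for e
      using X[OF that] xW[of "X e"] by (metis IntI card_1_singletonE singletonD)
    \<comment> \<open>Inside \<open>U\<close> the edges are disjoint because their projections are;
      inside \<open>W\<close> because \<open>w\<close> is injective.\<close>
    have disj: "X e \<inter> X e' = {}" if "e \<in> M" "e' \<in> M" "e \<noteq> e'" for e e'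
    proof -
      have "e \<inter> e' = {}"
        using M(2) that unfolding matching_def pairwise_def disjnt_def by blast
      then have "p (X e) \<inter> p (X e') = {}" using X that by simp
      then have "X e \<inter> X e' \<inter> U = {}" unfolding p_def by blast
      moreover have "w e \<noteq> w e'" using w(1) that unfolding inj_on_def by blast
      then have "(X e \<inter> W) \<inter> (X e' \<inter> W) = {}" using XW[OF that(1)] XW[OF that(2)] by simp
      moreover have "X e \<subseteq> U \<union> W" using xUW X[OF that(1)] by blast
      ultimately show ?thesis by blast
    qed
    \<comment> \<open>\<open>p\<close> is a left inverse of \<open>X\<close> on
      \<open>M\<close>.\<close>
    have "inj_on X M" by (rule inj_onI) (metis X)
    then have "card (X ` M) = m" using M(3) by (simp add: card_image)
    moreover have "matching (X ` M)"
      unfolding matching_def pairwise_def disjnt_def using disj by blast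
    moreover have "X ` M \<subseteq> H" using X by blast
    ultimately show "\<exists>M \<subseteq> H. matching M \<and> card M = m" by blast
  qed
  moreover have "a' > 0" unfolding a'_def by simp
  ultimately show ?thesis by blast
qed

end
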